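(* Let $\Pi\subset\mathbb R^2$ be the polygonal region with consecutive vertices $P_1,\dots,P_n$, and put $P_{n+1}=P_1$. A point $m\in\mathbb R^2$ is the geometric median of $\Pi$ if and only if $$\sum_{i=1}^{n}\frac{\Sigma_{P_iP_{i+1}}(m)}{|P_{i+1}-P_i|}\,\overrightarrow{P_iP_{i+1}}=0.$$
   Context: $|\cdot|$ is the Euclidean norm on $\mathbb R^2$, so $|P-X|$ is the Euclidean distance between the points $P$ and $X$. A polygonal region with vertices $P_1,\dots,P_n$ is the bounded region enclosed by the simple closed polygon $P_1P_2\dots P_nP_1$. For a region $\Omega\subset\mathbb R^2$ put $\Sigma_\Omega(X)=\int_{P\in\Omega}|P-X|\,dP$ (integral with respect to area), $X\in\mathbb R^2$. The geometric median of $\Omega$ is the point $m=\mathop{\mathrm{arg\,min}}_{X\in\mathbb R^2}\Sigma_\Omega(X)$. For points $A,B\in\mathbb R^2$, $\Sigma_{AB}(X)=\int_{P\in AB}|P-X|\,dP$ is the integral over the line segment $AB$ with respect to arc length. $\overrightarrow{AB}=B-A$. *)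

theory Defs
  imports "HOL-Analysis.Analysis"
begin

fun polygonal_path :: "(real^2) list \<Rightarrow> real \<Rightarrow> real^2" where
  "polygonal_path [] = linepath 0 0"
| "polygonal_path [a] = linepath a a"
| "polygonal_path [a, b] = linepath a b"
| "polygonal_path (a # b # c # xs) = linepath a b +++ polygonal_path (b # c # xs)"

text \<open>The closed polygon \<open>P 1, P 2, \<dots>, P n, P 1\<close>, traversed once.\<close>

definition closed_polygon :: "nat \<Rightarrow> (nat \<Rightarrow> real^2) \<Rightarrow> real \<Rightarrow> real^2" where
  "closed_polygon n P = polygonal_path (map P [1..<Suc n] @ [P 1])"

definition simple_closed_polygon :: "nat \<Rightarrow> (nat \<Rightarrow> real^2) \<Rightarrow> bool" where
  "simple_closed_polygon n P \<longleftrightarrow> n \<ge> 3 \<and> simple_path (closed_polygon n P)"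

text \<open>\<^const>\<open>inside\<close> yields the open region; whether the boundary is included does not affect
  integrals with respect to area.\<close>

definition polygonal_region :: "nat \<Rightarrow> (nat \<Rightarrow> real^2) \<Rightarrow> (real^2) set" where
  "polygonal_region n P = inside (path_image (closed_polygon n P))"

definition region_dist_sum :: "(real^2) set \<Rightarrow> real^2 \<Rightarrow> real" where
  "region_dist_sum \<Omega> X = (LINT P:\<Omega>|lebesgue. norm (P - X))"

definition arclength_integral :: "(real^2 \<Rightarrow> real) \<Rightarrow> (real \<Rightarrow> real^2) \<Rightarrow> real" where
  "arclength_integral f g =
     integral {0..1} (\<lambda>t. f (g t) * norm (vector_derivative g (at t within {0..1})))"

definition segment_dist_sum :: "real^2 \<Rightarrow> real^2 \<Rightarrow> real^2 \<Rightarrow> real" where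
  "segment_dist_sum A B X = arclength_integral (\<lambda>P. norm (P - X)) (linepath A B)"

text \<open>The equation \<open>m = arg min \<Sigma>\<close> is read as: \<open>m\<close> is the one and only minimiser.\<close>

definition is_geometric_median :: "(real^2) set \<Rightarrow> real^2 \<Rightarrow> bool" where
  "is_geometric_median \<Omega> m \<longleftrightarrow>
     {X. is_arg_min (region_dist_sum \<Omega>) (\<lambda>_. True) X} = {m}"

end

theory Submission
  imports Defs "HOL-Complex_Analysis.Winding_Numbers"
begin

text \<open>
  Write \<open>sgn v = v / |v|\<close>. Integrating the inequality
  \<open>|z - X| \<ge> |z - m| + sgn (z - m) \<bullet> (m - X)\<close>, strict off a line, shows that \<open>m\<close> is the geometric
  median iff the integral of \<open>sgn (z - m)\<close> over the region vanishes. Winding numbers show that,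
  almost everywhere and up to one global sign, the indicator of the region is the sum of the
  indicators of the triangles \<open>m P\<^sub>i P\<^sub>i\<^sub>+\<^sub>1\<close> weighted by their orientations. As \<open>sgn (z - m)\<close> is
  constant on rays from \<open>m\<close>, its integral over such a triangle is the integral of \<open>sgn (C t - m)\<close>
  along the opposite side \<open>C t\<close> times the area. By the fundamental theorem of calculus for
  \<open>|C t - m|\<close> times the rotated vector \<open>C t - m\<close>, this equals minus the rotated edge times the
  integral of \<open>|C t - m|\<close>, up to terms that telescope around the polygon.
\<close>

subsection \<open>Decomposing the polygon into a fan of triangles\<close>

text \<open>Winding numbers live in the complex plane; this linear bijection carries the polygon
  there.\<close>

definition to_complex :: "real^2 \<Rightarrow> complex" where
  "to_complex v = Complex (v $ 1) (v $ 2)"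

text \<open>Twice the signed area of the triangle with vertices \<open>0\<close>, \<open>u\<close>,
  \<open>v\<close>; positive when the turn from \<open>u\<close> to \<open>v\<close> is
  counterclockwise.\<close>

definition cross2 :: "real^2 \<Rightarrow> real^2 \<Rightarrow> real" where
  "cross2 u v = u $ 1 * v $ 2 - u $ 2 * v $ 1"

lemma linear_to_complex: "linear to_complex"
  by (intro linearI) (auto simp: to_complex_def complex_eq_iff)

lemma inj_to_complex: "inj to_complex"
  by (intro injI) (auto simp: to_complex_def vec_eq_iff forall_2)

lemma surj_to_complex: "surj to_complex"
proof (rule surjI)
  show "to_complex (vector [Re z, Im z]) = z" for z
    by (simp add: to_complex_def)
qed

lemma to_complex_in_image_iff: "to_complex z \<in> to_complex ` S \<longleftrightarrow> z \<in> S"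
  using inj_to_complex by (simp add: inj_image_mem_iff)

text \<open>A linear bijection is a homeomorphism, so it maps components of the complement of
  \<open>S\<close> to components of the complement of the image. Boundedness passes both ways
  because the inverse is linear too.\<close>

lemma inside_linear_image:
  fixes f :: "'a::euclidean_space \<Rightarrow> 'b::euclidean_space"
  assumes "linear f" "inj f" "surj f"
  shows "inside (f ` S) = f ` inside S"
proof -
  have compl: "- f ` S = f ` (- S)"
    using assms(2,3) by (simp add: bij_def bij_image_Compl_eq)
  obtain g where "homeomorphism (f ` (- S)) (- S) g f"
    using linear_homeomorphism_image [OF assms(1,2)] .
  then have hom: "homeomorphism (- S) (f ` (- S)) f g"
    using homeomorphism_sym by blast
  have comp: "connected_component_set (- f ` S) (f x) = f ` connected_component_set (- S) x"
    if "x \<notin> S" for x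
    using connected_component_set_homeomorphism [OF hom, of x] that compl by simp
  have bdd: "bounded (f ` T) \<longleftrightarrow> bounded T" for T
  proof
    assume bf: "bounded (f ` T)"
    obtain h where h: "linear h" "h \<circ> f = id"
      using assms(1,2) linear_injective_left_inverse by blast
    have "bounded (h ` f ` T)"
      using bf h(1) by (simp add: bounded_linear_image linear_conv_bounded_linear)
    then show "bounded T"
      using h by (simp add: image_comp)
  qed (use assms(1) in \<open>auto intro: bounded_linear_image simp: linear_conv_bounded_linear\<close>)
  have "f x \<in> inside (f ` S) \<longleftrightarrow> x \<in> inside S" for x
    using comp [of x] bdd assms(2) by (auto simp: inside_def inj_image_mem_iff)
  then show ?thesis
    using assms(2,3) by (metis (no_types, lifting) inj_image_mem_iff subset_antisym subsetI surj_def)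
qed

lemma compose_linepath_linear:
  assumes "linear f"
  shows "f \<circ> linepath a b = linepath (f a) (f b)"
  using assms by (auto simp: linepath_def fun_eq_iff linear_add linear_scale)

section \<open>Polygonal paths and their winding numbers\<close>

lemma polygonal_path_endpoints [simp]:
  assumes "xs \<noteq> []"
  shows "pathstart (polygonal_path xs) = hd xs" "pathfinish (polygonal_path xs) = last xs"
  using assms by (induction xs rule: polygonal_path.induct) auto

lemma path_polygonal_path [simp]: "path (polygonal_path xs)"
proof (induction xs rule: polygonal_path.induct)
  case (4 a b c xs)
  then show ?case by simp
qed (simp_all only: polygonal_path.simps path_linepath)

lemma path_image_polygonal_path:
  assumes "2 \<le> length xs"
  shows "path_image (polygonal_path xs) = (\<Union>i<length xs - 1. closed_segment (xs ! i) (xs ! Suc i))"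
  using assms
proof (induction xs rule: polygonal_path.induct)
  case (4 a b c xs)
  then show ?case
    by (simp add: path_image_join lessThan_Suc_eq_insert_0 image_comp o_def)
qed auto

text \<open>Winding numbers add along concatenated paths. A single segment is an open path: the real
  part of its term is the angle swept as seen from \<open>z\<close>, as a fraction of a full turn,
  and need not be an integer.\<close>

lemma winding_number_polygonal_path:
  assumes "2 \<le> length xs"
    and "to_complex z \<notin> path_image (to_complex \<circ> polygonal_path xs)"
  shows "winding_number (to_complex \<circ> polygonal_path xs) (to_complex z) =
    (\<Sum>i<length xs - 1. winding_number (linepath (to_complex (xs ! i)) (to_complex (xs ! Suc i)))
       (to_complex z))"
  using assms
proof (induction xs rule: polygonal_path.induct)
  case (4 a b c xs)
  have eq: "to_complex \<circ> polygonal_path (a # b # c # xs) =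
      linepath (to_complex a) (to_complex b) +++ (to_complex \<circ> polygonal_path (b # c # xs))"
    by (simp add: path_compose_join compose_linepath_linear linear_to_complex)
  have pth: "path (to_complex \<circ> polygonal_path (b # c # xs))"
    using linear_to_complex inj_to_complex path_linear_image_eq by (metis path_polygonal_path)
  have fin: "pathfinish (linepath (to_complex a) (to_complex b)) =
      pathstart (to_complex \<circ> polygonal_path (b # c # xs))"
    by (simp add: pathstart_compose)
  have notin: "to_complex z \<notin> path_image (linepath (to_complex a) (to_complex b))"
    "to_complex z \<notin> path_image (to_complex \<circ> polygonal_path (b # c # xs))"
    using 4(3) fin unfolding eq by (simp_all add: path_image_join)
  have "winding_number (to_complex \<circ> polygonal_path (a # b # c # xs)) (to_complex z) =
      winding_number (linepath (to_complex a) (to_complex b)) (to_complex z) +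
      winding_number (to_complex \<circ> polygonal_path (b # c # xs)) (to_complex z)"
    unfolding eq using notin pth fin by (intro winding_number_join) auto
  also have "winding_number (to_complex \<circ> polygonal_path (b # c # xs)) (to_complex z) =
     (\<Sum>i<length (b # c # xs) - 1. winding_number (linepath (to_complex ((b # c # xs) ! i))
         (to_complex ((b # c # xs) ! Suc i))) (to_complex z))"
    by (rule 4(1) [OF _ notin(2)]) simp
  finally show ?case
    by (simp add: sum.lessThan_Suc_shift del: sum.lessThan_Suc)
qed (auto simp: compose_linepath_linear linear_to_complex)

lemma to_complex_closed_segment:
  "to_complex z \<in> closed_segment (to_complex a) (to_complex b) \<longleftrightarrow> z \<in> closed_segment a b"
  using closed_segment_linear_image [OF linear_to_complex, of a b]
  by (simp add: to_complex_in_image_iff)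

text \<open>The degenerate case is included: the triangle then lies on its own boundary.\<close>

lemma winding_number_triangle_cross2:
  fixes z a b c :: "real^2"
  assumes "z \<notin> closed_segment a b" "z \<notin> closed_segment b c" "z \<notin> closed_segment c a"
  shows "winding_number (linepath (to_complex a) (to_complex b) +++
      linepath (to_complex b) (to_complex c) +++ linepath (to_complex c) (to_complex a)) (to_complex z) =
     of_real (sgn (cross2 (b - a) (c - a)) * indicator (convex hull {a, b, c}) z)"
proof -
  let ?a = "to_complex a" and ?b = "to_complex b" and ?c = "to_complex c" and ?z = "to_complex z"
  let ?T = "linepath ?a ?b +++ linepath ?b ?c +++ linepath ?c ?a"
  have hull: "convex hull {?a, ?b, ?c} = to_complex ` (convex hull {a, b, c})"
    using convex_hull_linear_image [OF linear_to_complex, of "{a,b,c}"] by simp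
  show ?thesis
  proof (cases "z \<in> convex hull {a, b, c}")
    case False
    have "winding_number ?T ?z = 0"
    proof (rule winding_number_zero_outside)
      have "closed_segment u v \<subseteq> convex hull {?a, ?b, ?c}" if "u \<in> {?a, ?b, ?c}" "v \<in> {?a, ?b, ?c}" for u v
        using that by (intro closed_segment_subset hull_inc) auto
      then show "path_image ?T \<subseteq> convex hull {?a, ?b, ?c}"
        by (simp add: path_image_join)
      show "?z \<notin> convex hull {?a, ?b, ?c}"
        using False by (simp add: hull to_complex_in_image_iff)
    qed auto
    with False show ?thesis by simp
  next
    case True
    then obtain u v where uv: "0 \<le> u" "0 \<le> v" "u + v \<le> 1"
      and z: "z = a + u *\<^sub>R (b - a) + v *\<^sub>R (c - a)"
      by (auto simp: convex_hull_3_alt)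
    have "v \<noteq> 0"
    proof
      assume "v = 0"
      then have "z \<in> closed_segment a b"
        using uv unfolding z closed_segment_def by (auto simp: algebra_simps intro!: exI [of _ u])
      with assms show False by simp
    qed
    with uv have v: "v > 0" by simp
    have int: "?z \<in> interior (convex hull {?a, ?b, ?c})"
      unfolding interior_of_triangle [OF DIM_complex] unfolding hull
      using True assms by (simp add: to_complex_in_image_iff to_complex_closed_segment)
    \<comment> \<open>The sign of this imaginary part decides between the winding numbers 1 and -1.
      As \<open>v > 0\<close>, the orientation of \<open>a\<close>, \<open>b\<close>,
      \<open>z\<close> is that of \<open>a\<close>, \<open>b\<close>, \<open>c\<close>.\<close>
    have *: "Im ((?b - ?a) * cnj (?b - ?z)) = v * cross2 (b - a) (c - a)"
      by (simp add: to_complex_def cross2_def z algebra_simps)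
    \<comment> \<open>A degenerate triangle is a null set and has empty interior, whereas
      \<open>z\<close> is an interior point.\<close>
    have nz: "cross2 (b - a) (c - a) \<noteq> 0"
    proof
      assume 0: "cross2 (b - a) (c - a) = 0"
      then have "Henstock_Kurzweil_Integration.content (convex hull {a, b, c}) = 0"
        by (subst content_triangle) (simp add: cross2_def algebra_simps)
      then have "negligible (convex hull {a, b, c})"
        by (simp add: negligible_iff_measure lmeasurable_compact compact_convex_hull
            measure_completion compact_imp_closed)
      then have "interior (convex hull {a, b, c}) = {}"
        using negligible_subset [OF _ interior_subset] open_not_negligible open_interior by blast
      moreover have "z \<in> interior (convex hull {a, b, c})"
        using True assms by (simp add: interior_of_triangle)
      ultimately show False by simp
    qed
    show ?thesis
      using winding_number_triangle [OF int] True v nz unfolding *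
      by (auto simp: zero_less_mult_iff sgn_if)
  qed
qed

text \<open>Reversing the last side negates its term, so the two sides at the apex \<open>a\<close>
  enter as a difference, ready to telescope over the fan.\<close>

lemma winding_number_fan_triangle:
  assumes "z \<notin> closed_segment a b" "z \<notin> closed_segment b c" "z \<notin> closed_segment c a"
  shows "winding_number (linepath a b +++ linepath b c +++ linepath c a) z =
    winding_number (linepath a b) z + winding_number (linepath b c) z - winding_number (linepath a c) z"
proof -
  have "winding_number (linepath a b +++ linepath b c +++ linepath c a) z =
    winding_number (linepath a b) z + (winding_number (linepath b c) z + winding_number (linepath c a) z)"
    using assms by (simp add: winding_number_join path_image_join)
  also have "winding_number (linepath c a) z = - winding_number (linepath a c) z"
    using winding_number_reversepath [of "linepath a c" z] assms
    by (simp add: closed_segment_commute)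
  finally show ?thesis by simp
qed

text \<open>The winding number of an edge is that of its triangle with apex \<open>m\<close> plus a
  difference of spoke terms. The spokes cancel around the polygon, and the total is the winding
  number of a simple closed curve: \<open>\<epsilon>\<close> inside, 0 outside, where
  \<open>\<epsilon>\<close> is the orientation of the polygon.\<close>

lemma polygon_fan_indicator:
  assumes simple: "simple_closed_polygon n P" and closed: "P (n + 1) = P 1"
  obtains \<epsilon> :: real where "\<bar>\<epsilon>\<bar> = 1"
    and "\<And>z. \<lbrakk>\<And>i. i \<in> {1..n} \<Longrightarrow> z \<notin> closed_segment (P i) (P (i + 1)) \<and>
            z \<notin> closed_segment m (P i) \<and> z \<notin> closed_segment (P (i + 1)) m\<rbrakk> \<Longrightarrow>
      (\<Sum>i = 1..n. sgn (cross2 (P i - m) (P (i + 1) - m)) *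
          indicator (convex hull {m, P i, P (i + 1)}) z) = \<epsilon> * indicator (polygonal_region n P) z"
proof -
  \<comment> \<open>The last entry is \<open>P (n + 1)\<close>, which repeats \<open>P 1\<close>.
    Entry \<open>i\<close>, counted from 0, is thus vertex \<open>i + 1\<close> for every
    \<open>i \<le> n\<close>.\<close>
  define xs where "xs = map P [1..<n + 2]"
  have n: "n \<ge> 3" and sp: "simple_path (closed_polygon n P)"
    using simple by (auto simp: simple_closed_polygon_def)
  have xs: "closed_polygon n P = polygonal_path xs"
    using closed by (simp add: closed_polygon_def xs_def)
  have nth: "xs ! i = P (i + 1)" if "i \<le> n" for i
    using that by (auto simp: xs_def simp del: upt_Suc)
  have len: "length xs = n + 1"
    by (simp add: xs_def)
  define g where "g = to_complex \<circ> closed_polygon n P"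
  have spg: "simple_path g"
    using sp simple_path_linear_image_eq [OF linear_to_complex inj_to_complex] by (simp add: g_def)
  have loop: "pathfinish g = pathstart g"
    using len nth [of 0] nth [of n] closed
    by (simp add: g_def xs pathfinish_compose pathstart_compose polygonal_path_endpoints
        hd_conv_nth last_conv_nth flip: length_greater_0_conv)
  have img: "path_image g = to_complex ` path_image (closed_polygon n P)"
    by (simp add: g_def path_image_compose)
  have ins: "inside (path_image g) = to_complex ` polygonal_region n P"
    using inside_linear_image [OF linear_to_complex inj_to_complex surj_to_complex]
    by (simp add: img polygonal_region_def)
  \<comment> \<open>Inside a simple closed curve the winding number is constantly 1 or constantly
    -1.\<close>
  obtain \<epsilon> :: real where e: "\<bar>\<epsilon>\<bar> = 1" and win: "\<And>w. w \<in> inside (path_image g) \<Longrightarrow> winding_number g w = \<epsilon>"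
  proof (rule simple_closed_path_winding_number_inside [OF spg])
    assume "\<And>z. z \<in> inside (path_image g) \<Longrightarrow> winding_number g z = 1"
    then show ?thesis by (intro that [of 1]) auto
  next
    assume "\<And>z. z \<in> inside (path_image g) \<Longrightarrow> winding_number g z = - 1"
    then show ?thesis by (intro that [of "-1"]) auto
  qed
  show ?thesis
  proof (rule that [OF e])
    fix z
    assume z: "\<And>i. i \<in> {1..n} \<Longrightarrow> z \<notin> closed_segment (P i) (P (i + 1)) \<and>
            z \<notin> closed_segment m (P i) \<and> z \<notin> closed_segment (P (i + 1)) m"
    let ?h = to_complex
    have "z \<notin> path_image (closed_polygon n P)"
      using z len nth n by (auto simp: xs path_image_polygonal_path)
    then have notin: "?h z \<notin> path_image g"
      by (simp add: img to_complex_in_image_iff)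
    have "winding_number g (?h z) = of_real (\<epsilon> * indicator (polygonal_region n P) z)"
    proof (cases "z \<in> polygonal_region n P")
      case True
      then show ?thesis using win [of "?h z"] by (simp add: ins)
    next
      case False
      then have "?h z \<in> outside (path_image g)"
        using notin by (simp add: outside_inside ins to_complex_in_image_iff)
      then show ?thesis
        using False winding_number_zero_in_outside [OF _ loop] spg by (simp add: simple_path_imp_path)
    qed
    moreover
    have "winding_number g (?h z) =
        (\<Sum>i<n. winding_number (linepath (?h (P (i + 1))) (?h (P (i + 2)))) (?h z))"
      using winding_number_polygonal_path [of xs z] notin n
      by (simp add: g_def xs len nth)
    also have "\<dots> = (\<Sum>i = 1..n. winding_number (linepath (?h (P i)) (?h (P (i + 1)))) (?h z))"
      by (rule sum.reindex_bij_witness [of _ "\<lambda>i. i - 1" "\<lambda>i. i + 1"]) auto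
    also have "\<dots> = (\<Sum>i = 1..n. of_real (sgn (cross2 (P i - m) (P (i + 1) - m)) *
          indicator (convex hull {m, P i, P (i + 1)}) z)
         + (winding_number (linepath (?h m) (?h (P (Suc i)))) (?h z)
            - winding_number (linepath (?h m) (?h (P i))) (?h z)))"
    proof (rule sum.cong [OF refl])
      fix i assume i: "i \<in> {1..n}"
      show "winding_number (linepath (?h (P i)) (?h (P (i + 1)))) (?h z) =
        of_real (sgn (cross2 (P i - m) (P (i + 1) - m)) *
          indicator (convex hull {m, P i, P (i + 1)}) z)
         + (winding_number (linepath (?h m) (?h (P (Suc i)))) (?h z)
            - winding_number (linepath (?h m) (?h (P i))) (?h z))"
        using winding_number_triangle_cross2 [of z m "P i" "P (i + 1)"] z [OF i]
          winding_number_fan_triangle [of "?h z" "?h m" "?h (P i)" "?h (P (i + 1))"]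
        by (simp add: to_complex_closed_segment algebra_simps)
    qed
    \<comment> \<open>The spoke terms telescope to the one for \<open>P (n + 1)\<close> minus the
      one for \<open>P 1\<close>, which are equal.\<close>
    also have "\<dots> = of_real (\<Sum>i = 1..n. sgn (cross2 (P i - m) (P (i + 1) - m)) *
          indicator (convex hull {m, P i, P (i + 1)}) z)"
      using n closed sum_Suc_diff [of 1 n "\<lambda>i. winding_number (linepath (?h m) (?h (P i))) (?h z)"]
      by (simp add: sum.distrib del: of_real_mult sum_mult_indicator)
    ultimately show "(\<Sum>i = 1..n. sgn (cross2 (P i - m) (P (i + 1) - m)) *
          indicator (convex hull {m, P i, P (i + 1)}) z) = \<epsilon> * indicator (polygonal_region n P) z"
      by (simp only: of_real_eq_iff)
  qed
qed

subsection \<open>Integrating over a triangle\<close>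

text \<open>The counterclockwise quarter turn. Integrals of \<open>sgn (z - m)\<close> come out as
  combinations of rotated edges, and injectivity of \<open>rot\<close> removes the rotation at the
  end.\<close>

definition rot :: "real^2 \<Rightarrow> real^2" where
  "rot v = vector [- v $ 2, v $ 1]"

lemma rot_nth [simp]: "rot v $ 1 = - v $ 2" "rot v $ 2 = v $ 1"
  by (simp_all add: rot_def)

lemma linear_rot: "linear rot"
  by (intro linearI) (auto simp: vec_eq_iff forall_2)

lemma rot_eq_0_iff [simp]: "rot v = 0 \<longleftrightarrow> v = 0"
  by (auto simp: vec_eq_iff forall_2)

lemma rot_0 [simp]: "rot 0 = 0"
  by simp

lemma cross2_eq_inner_rot: "cross2 u v = rot u \<bullet> v"
  by (simp add: cross2_def inner_vec_def sum_2)

section \<open>Areas, integrability and subdivision of triangles\<close>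

lemma measure_triangle:
  "measure lebesgue (convex hull {m, a, b}) = \<bar>cross2 (a - m) (b - m)\<bar> / 2"
proof -
  have "measure lebesgue (convex hull {m, a, b}) = measure lborel (convex hull {m, a, b})"
    by (simp add: measure_completion compact_imp_closed compact_convex_hull)
  then show ?thesis
    by (simp add: content_triangle cross2_def abs_minus_commute mult.commute)
qed

lemma lmeasurable_triangle [simp]: "convex hull {m, a, b :: real^2} \<in> lmeasurable"
  by (simp add: lmeasurable_compact compact_convex_hull)

lemma negligible_triangle:
  "cross2 (a - m) (b - m) = 0 \<Longrightarrow> negligible (convex hull {m, a, b})"
  by (simp add: negligible_iff_measure measure_triangle)

lemma set_integrable_bounded:
  fixes f :: "'a::euclidean_space \<Rightarrow> 'b::euclidean_space"
  assumes f: "f \<in> borel_measurable borel" and S: "S \<in> lmeasurable"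
    and bound: "\<And>x. x \<in> S \<Longrightarrow> norm (f x) \<le> c"
  shows "set_integrable lebesgue S f"
proof (rule set_integrable_bound [where f = "\<lambda>_. c"])
  show "set_integrable lebesgue S (\<lambda>_. c)"
    using S by (simp add: set_integrable_def lmeasurable_iff_integrable)
  have "f \<in> borel_measurable lebesgue"
    using f by (simp add: measurable_completion)
  then show "set_borel_measurable lebesgue S f"
    using S unfolding set_borel_measurable_def
    by (intro borel_measurable_scaleR borel_measurable_indicator) auto
  show "AE x in lebesgue. x \<in> S \<longrightarrow> norm (f x) \<le> norm c"
    using bound by (fastforce intro: AE_I2)
qed

lemma set_integrable_sgn [simp]:
  fixes m :: "'a::euclidean_space"
  assumes "S \<in> lmeasurable"
  shows "set_integrable lebesgue S (\<lambda>z. sgn (z - m))"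
proof (rule set_integrable_bounded [where c = 1])
  show "(\<lambda>z. sgn (z - m)) \<in> borel_measurable borel"
    by measurable
qed (use assms in \<open>auto simp: norm_sgn\<close>)

lemma set_integral_negligible:
  fixes f :: "'a::euclidean_space \<Rightarrow> 'b::euclidean_space"
  assumes "negligible S"
  shows "(LINT z:S|lebesgue. f z) = 0"
proof -
  have "AE z in lebesgue. z \<notin> S"
    using assms by (intro AE_not_in) (simp add: negligible_iff_null_sets)
  then show ?thesis
    unfolding set_lebesgue_integral_def by (intro integral_eq_zero_AE) (auto simp: indicator_def elim: eventually_mono)
qed

text \<open>The segment from \<open>m\<close> to the point \<open>C\<close> of the side
  \<open>A B\<close> cuts the triangle in two. The parts meet only on the line through
  \<open>m\<close> and \<open>C\<close>, unless the whole triangle is degenerate and hence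
  negligible.\<close>

lemma triangle_split:
  fixes m A B :: "real^2"
  assumes t: "0 \<le> t" "t \<le> 1" and C: "C = A + t *\<^sub>R (B - A)"
  shows "convex hull {m, A, B} = convex hull {m, A, C} \<union> convex hull {m, C, B}" (is "?T = ?L \<union> ?R")
    and "negligible (convex hull {m, A, C} \<inter> convex hull {m, C, B})"
proof -
  have "C \<in> closed_segment A B"
    unfolding closed_segment_def C using t by (intro CollectI exI [of _ t]) (simp add: algebra_simps)
  then have "C \<in> convex hull {A, B}"
    by (simp add: segment_convex_hull)
  then have C_in: "C \<in> ?T"
    using hull_mono [of "{A, B}" "{m, A, B}"] by blast
  then have sub: "?L \<union> ?R \<subseteq> ?T"
    by (simp add: convex_hull_subset hull_inc)
  have "?T \<subseteq> ?L \<union> ?R"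
  proof
    fix z assume "z \<in> ?T"
    then obtain x y where xy: "0 \<le> x" "0 \<le> y" "x + y \<le> 1"
      and z: "z = m + x *\<^sub>R (A - m) + y *\<^sub>R (B - m)"
      by (auto simp: convex_hull_3_alt)
    have Cm: "C - m = (1 - t) *\<^sub>R (A - m) + t *\<^sub>R (B - m)"
      by (simp add: C algebra_simps)
    show "z \<in> ?L \<union> ?R"
    \<comment> \<open>For a nondegenerate triangle this comparison tells on which side of the line
      through \<open>m\<close> and \<open>C\<close> the point lies.\<close>
    proof (cases "(1 - t) * y \<le> t * x")
      case le: True
      show ?thesis
      proof (cases "t = 0")
        case True
        then have "?R = ?T" by (simp add: C)
        with \<open>z \<in> ?T\<close> show ?thesis by simp
      next
        case False
        with t have t0: "t > 0" by simp
        \<comment> \<open>The coefficient of \<open>C - m\<close> once \<open>B - m\<close> is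
          eliminated by means of \<open>Cm\<close>.\<close>
        define q where "q = y / t"
        have y: "y = t * q" using t0 by (simp add: q_def)
        have "(1 - t) * q \<le> x"
        proof -
          have "t * ((1 - t) * q) \<le> t * x"
            using le unfolding y by (simp add: mult.left_commute)
          with t0 show ?thesis by simp
        qed
        moreover have "z = m + (x - (1 - t) * q) *\<^sub>R (A - m) + q *\<^sub>R (C - m)"
          unfolding Cm z y by (simp add: algebra_simps)
        moreover have "0 \<le> q" using xy t0 by (simp add: q_def)
        moreover have "(x - (1 - t) * q) + q \<le> 1" using xy y by (simp add: algebra_simps)
        ultimately have "z \<in> ?L"
          unfolding convex_hull_3_alt by (intro CollectI exI [of _ "x - (1 - t) * q"] exI [of _ q]) auto
        then show ?thesis ..
      qed
    next
      case gt: False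
      have t1: "1 - t > 0"
      proof (rule ccontr)
        assume "\<not> 1 - t > 0"
        with t have "t = 1" by simp
        with gt xy show False by simp
      qed
      \<comment> \<open>Here \<open>A - m\<close> is eliminated instead.\<close>
      define q where "q = x / (1 - t)"
      have x: "x = (1 - t) * q" using t1 by (simp add: q_def)
      have "(1 - t) * (t * q) \<le> (1 - t) * y"
        using gt unfolding x by (simp add: algebra_simps)
      then have "t * q \<le> y"
        using t1 by simp
      moreover have "z = m + q *\<^sub>R (C - m) + (y - t * q) *\<^sub>R (B - m)"
        unfolding Cm z x by (simp add: algebra_simps)
      moreover have "0 \<le> q" using xy t1 by (simp add: q_def)
      moreover have "q + (y - t * q) \<le> 1" using xy x by (simp add: algebra_simps)
      ultimately have "z \<in> ?R"
        unfolding convex_hull_3_alt by (intro CollectI exI [of _ "y - t * q"] exI [of _ q]) auto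
      then show ?thesis ..
    qed
  qed
  with sub show "?T = ?L \<union> ?R" by blast
  define D where "D = cross2 (A - m) (B - m)"
  show "negligible (?L \<inter> ?R)"
  proof (cases "D = 0")
    case True
    then have "negligible ?T"
      by (simp add: D_def negligible_triangle)
    then show ?thesis
      using sub by (auto intro: negligible_subset)
  next
    case D: False
    \<comment> \<open>\<open>A\<close> and \<open>B\<close> lie weakly on opposite sides of the line
      through \<open>m\<close> and \<open>C\<close>. For a common point of both parts, two
      expressions of opposite sign therefore agree, and both vanish.\<close>
    have CA: "cross2 (C - m) (A - m) = - t * D" and CB: "cross2 (C - m) (B - m) = (1 - t) * D"
      by (simp_all add: cross2_def D_def C algebra_simps)
    have "C \<noteq> m"
      using CA CB D by (auto simp: cross2_def)
    have "?L \<inter> ?R \<subseteq> {z. rot (C - m) \<bullet> z = rot (C - m) \<bullet> m}"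
    proof clarify
      fix z assume "z \<in> ?L" "z \<in> ?R"
      then obtain x y u v where "0 \<le> x" "0 \<le> v" and z: "z = m + x *\<^sub>R (A - m) + y *\<^sub>R (C - m)"
        "z = m + u *\<^sub>R (C - m) + v *\<^sub>R (B - m)"
        unfolding convex_hull_3_alt by blast
      have "cross2 (C - m) (z - m) = x * cross2 (C - m) (A - m)"
        by (simp add: z(1) cross2_def algebra_simps)
      moreover have "cross2 (C - m) (z - m) = v * cross2 (C - m) (B - m)"
        by (simp add: z(2) cross2_def algebra_simps)
      ultimately have "(x * t + v * (1 - t)) * D = 0"
        and c: "cross2 (C - m) (z - m) = - (x * t) * D"
        by (simp_all add: CA CB algebra_simps)
      then have "x * t + v * (1 - t) = 0"
        using D by simp
      moreover have "0 \<le> x * t" "0 \<le> v * (1 - t)"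
        using \<open>0 \<le> x\<close> \<open>0 \<le> v\<close> t by simp_all
      ultimately have "x * t = 0" by linarith
      with c show "rot (C - m) \<bullet> z = rot (C - m) \<bullet> m"
        by (simp add: cross2_eq_inner_rot inner_diff_right)
    qed
    moreover have "negligible {z. rot (C - m) \<bullet> z = rot (C - m) \<bullet> m}"
      using \<open>C \<noteq> m\<close> by (intro negligible_hyperplane) simp
    ultimately show ?thesis
      by (rule negligible_subset [rotated])
  qed
qed

lemma triangle_integral_sgn_split:
  fixes m A B :: "real^2"
  assumes "0 \<le> t" "t \<le> 1" "C = A + t *\<^sub>R (B - A)"
  shows "(LINT z:convex hull {m, A, B}|lebesgue. sgn (z - m)) =
    (LINT z:convex hull {m, A, C}|lebesgue. sgn (z - m)) + (LINT z:convex hull {m, C, B}|lebesgue. sgn (z - m))"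
  unfolding triangle_split(1) [OF assms]
proof (rule set_integral_Un_AE)
  have "convex hull {m, A, C} \<inter> convex hull {m, C, B} \<in> null_sets lebesgue"
    using triangle_split(2) [OF assms] by (simp add: negligible_iff_null_sets)
  from AE_not_in [OF this]
  show "AE z in lebesgue. \<not> (z \<in> convex hull {m, A, C} \<and> z \<in> convex hull {m, C, B})"
    by simp
qed (auto intro: fmeasurableD)

text \<open>By homogeneity, the values of \<open>sgn (z - m)\<close> on the triangle are those on the side opposite to \<open>m\<close>.\<close>

lemma triangle_integral_approx:
  fixes m A B :: "real^2"
  assumes "\<And>s. \<lbrakk>0 \<le> s; s \<le> 1\<rbrakk> \<Longrightarrow> norm (sgn (A + s *\<^sub>R (B - A) - m) - w) \<le> e"
  shows "norm ((LINT z:convex hull {m, A, B}|lebesgue. sgn (z - m)) -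
      (\<bar>cross2 (A - m) (B - m)\<bar> / 2) *\<^sub>R w) \<le> \<bar>cross2 (A - m) (B - m)\<bar> / 2 * e"
proof -
  let ?T = "convex hull {m, A, B}"
  have const: "set_integrable lebesgue ?T (\<lambda>_. c :: 'a :: euclidean_space)" for c
    by (rule set_integrable_bounded [where c = "norm c"]) auto
  have lint_const: "(LINT z:?T|lebesgue. c) = (\<bar>cross2 (A - m) (B - m)\<bar> / 2) *\<^sub>R c" for c :: "'a :: euclidean_space"
    using lmeasurable_triangle [of m A B]
    by (simp add: set_lebesgue_integral_def lmeasurable_iff_integrable flip: measure_triangle)
  have diff: "set_integrable lebesgue ?T (\<lambda>z. sgn (z - m) - w)"
    by (intro set_integral_diff const) simp
  have bound: "norm (sgn (z - m) - w) \<le> e" if "z \<in> ?T" "z \<noteq> m" for z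
  proof -
    obtain u v where uv: "0 \<le> u" "0 \<le> v" "u + v \<le> 1" and z: "z = m + u *\<^sub>R (A - m) + v *\<^sub>R (B - m)"
      using \<open>z \<in> ?T\<close> by (auto simp: convex_hull_3_alt)
    have "u + v \<noteq> 0"
    proof
      assume "u + v = 0"
      with uv have "u = 0" "v = 0" by linarith+
      with z \<open>z \<noteq> m\<close> show False by simp
    qed
    with uv have pos: "u + v > 0" by simp
    \<comment> \<open>The parameter at which the ray from \<open>m\<close> through \<open>z\<close>
      meets the line \<open>A B\<close>.\<close>
    define s where "s = v / (u + v)"
    have v: "v = (u + v) * s" using pos by (simp add: s_def)
    have u: "u = (u + v) * (1 - s)" using v by (simp add: algebra_simps)
    have "z - m = u *\<^sub>R (A - m) + v *\<^sub>R (B - m)" by (simp add: z)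
    also have "\<dots> = ((u + v) * (1 - s)) *\<^sub>R (A - m) + ((u + v) * s) *\<^sub>R (B - m)"
      using u v by simp
    also have "\<dots> = (u + v) *\<^sub>R (A + s *\<^sub>R (B - A) - m)"
      by (simp add: algebra_simps)
    finally have "sgn (z - m) = sgn (A + s *\<^sub>R (B - A) - m)"
      using pos by (simp add: sgn_scaleR)
    moreover have "0 \<le> s" "s \<le> 1"
      using uv pos by (simp_all add: s_def)
    ultimately show ?thesis using assms by simp
  qed
  have "(LINT z:?T|lebesgue. sgn (z - m)) - (\<bar>cross2 (A - m) (B - m)\<bar> / 2) *\<^sub>R w
      = (LINT z:?T|lebesgue. sgn (z - m) - w)"
    by (simp add: set_integral_diff const lint_const)
  also have "norm \<dots> \<le> (LINT z:?T|lebesgue. norm (sgn (z - m) - w))"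
    by (rule set_integral_norm_bound [OF diff])
  also have "\<dots> \<le> (LINT z:?T|lebesgue. e)"
  proof (rule set_integral_mono_AE)
    \<comment> \<open>At the apex \<open>sgn 0 = 0\<close> is a default value and the bound may
      fail, but a single point is a null set.\<close>
    have "AE z in lebesgue. z \<notin> {m}"
      by (rule AE_not_in) (simp flip: negligible_iff_null_sets)
    then show "AE z\<in>?T in lebesgue. norm (sgn (z - m) - w) \<le> e"
      by eventually_elim (use bound in auto)
  qed (use const set_integrable_norm [OF diff] in auto)
  also have "\<dots> = \<bar>cross2 (A - m) (B - m)\<bar> / 2 * e"
    by (simp add: lint_const)
  finally show ?thesis .
qed

text \<open>Let a point \<open>C t\<close> run along the side, so that the segment from
  \<open>m\<close> to it sweeps the triangle at constant area rate. On a thin slice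
  \<open>sgn (z - m)\<close> is nearly \<open>sgn (C t - m)\<close>, which gives the derivative of
  the swept integral; the fundamental theorem of calculus does the rest.\<close>

lemma triangle_integral_eq_segment_integral:
  fixes m A B :: "real^2"
  assumes D: "cross2 (A - m) (B - m) \<noteq> 0"
  shows "((\<lambda>t. (\<bar>cross2 (A - m) (B - m)\<bar> / 2) *\<^sub>R sgn (A + t *\<^sub>R (B - A) - m)) has_integral
    (LINT z:convex hull {m, A, B}|lebesgue. sgn (z - m))) {0..1}"
proof -
  define K where "K = \<bar>cross2 (A - m) (B - m)\<bar> / 2"
  have K: "K > 0" using D by (simp add: K_def)
  define C where "C = (\<lambda>t. A + t *\<^sub>R (B - A))"
  \<comment> \<open>The integral over the part of the triangle swept out so far; thin slices determine its derivative.\<close>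
  define H where "H = (\<lambda>t. LINT z:convex hull {m, A, C t}|lebesgue. sgn (z - m))"
  have cross_C: "\<bar>cross2 (C a - m) (C b - m)\<bar> / 2 = (b - a) * K" if "a \<le> b" for a b
  proof -
    have "cross2 (C a - m) (C b - m) = (b - a) * cross2 (A - m) (B - m)"
      by (simp add: C_def cross2_def algebra_simps)
    with that show ?thesis by (simp add: K_def abs_mult)
  qed
  \<comment> \<open>The line \<open>A B\<close> misses \<open>m\<close>, so
    \<open>sgn (C t - m)\<close> is continuous in \<open>t\<close>.\<close>
  have Cm: "C t \<noteq> m" for t
  proof
    assume "C t = m"
    moreover have "cross2 (C t - m) (B - A) = cross2 (A - m) (B - m)"
      by (simp add: C_def cross2_def algebra_simps)
    ultimately show False using D by (simp add: cross2_def)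
  qed
  have H_diff: "H b - H a = (LINT z:convex hull {m, C a, C b}|lebesgue. sgn (z - m))"
    if "0 \<le> a" "a \<le> b" for a b
  proof -
    \<comment> \<open>For \<open>b = 0\<close> also \<open>a = 0\<close>, and the default
      \<open>a / b = 0\<close> is the right ratio.\<close>
    have "C a = A + (a / b) *\<^sub>R (C b - A)"
      using that by (cases "b = 0") (auto simp: C_def)
    then show ?thesis
      using that triangle_integral_sgn_split [of "a / b" "C a" A "C b" m]
      by (simp add: H_def divide_le_eq)
  qed
  have approx: "norm (H b - H a - ((b - a) * K) *\<^sub>R w) \<le> (b - a) * K * e"
    if "0 \<le> a" "a \<le> b" and *: "\<And>s. \<lbrakk>a \<le> s; s \<le> b\<rbrakk> \<Longrightarrow> norm (sgn (C s - m) - w) \<le> e" for a b w e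
  proof -
    have "norm (sgn (C a + s *\<^sub>R (C b - C a) - m) - w) \<le> e" if "0 \<le> s" "s \<le> 1" for s
    proof -
      have "C a + s *\<^sub>R (C b - C a) = C (a + s * (b - a))"
        by (simp add: C_def algebra_simps)
      moreover have "s * (b - a) \<le> 1 * (b - a)"
        using that \<open>a \<le> b\<close> by (intro mult_right_mono) auto
      ultimately show ?thesis
        using * [of "a + s * (b - a)"] that \<open>a \<le> b\<close> by simp
    qed
    from triangle_integral_approx [OF this] show ?thesis
      unfolding H_diff [OF that(1,2)] cross_C [OF that(2)] by blast
  qed
  have "((\<lambda>t. K *\<^sub>R sgn (C t - m)) has_integral (H 1 - H 0)) {0..1}"
  proof (rule fundamental_theorem_of_calculus)
    fix t :: real assume t: "t \<in> {0..1}"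
    let ?w = "sgn (C t - m)"
    show "(H has_vector_derivative K *\<^sub>R ?w) (at t within {0..1})"
      unfolding has_vector_derivative_def has_derivative_within_alt
    proof (intro conjI allI impI)
      show "bounded_linear (\<lambda>x. x *\<^sub>R K *\<^sub>R ?w)"
        by (rule bounded_linear_scaleR_left)
      fix e :: real assume "e > 0"
      have "isCont (\<lambda>s. sgn (C s - m)) t"
        using Cm [of t] unfolding C_def by (intro continuous_intros) auto
      \<comment> \<open>The tolerance \<open>e / K\<close> compensates for the area rate
        \<open>K\<close> in \<open>approx\<close>.\<close>
      then obtain d where d: "d > 0" "\<And>s. \<bar>s - t\<bar> < d \<Longrightarrow> norm (sgn (C s - m) - ?w) < e / K"
        using \<open>e > 0\<close> K unfolding continuous_at_eps_delta by (metis dist_norm real_norm_def zero_less_divide_iff)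
      have "norm (H s - H t - (s - t) *\<^sub>R K *\<^sub>R ?w) \<le> e * norm (s - t)"
        if s: "s \<in> {0..1}" "norm (s - t) < d" for s
      proof (cases "t \<le> s")
        case True
        then have "norm (H s - H t - ((s - t) * K) *\<^sub>R ?w) \<le> (s - t) * K * (e / K)"
          by (intro approx) (use t s d in \<open>auto intro: less_imp_le\<close>)
        with True K show ?thesis by (simp add: mult.commute)
      next
        case False
        \<comment> \<open>To the left of \<open>t\<close> the slice runs from \<open>s\<close> to
          \<open>t\<close>, and the resulting estimate is negated.\<close>
        then have "norm (H t - H s - ((t - s) * K) *\<^sub>R ?w) \<le> (t - s) * K * (e / K)"
          by (intro approx) (use t s d in \<open>auto intro: less_imp_le\<close>)
        moreover have "H t - H s - ((t - s) * K) *\<^sub>R ?w = - (H s - H t - (s - t) *\<^sub>R K *\<^sub>R ?w)"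
          by (simp add: algebra_simps)
        ultimately show ?thesis using False K by (simp only: norm_minus_cancel) (simp add: mult.commute)
      qed
      with \<open>d > 0\<close> show "\<exists>d>0. \<forall>s\<in>{0..1}. norm (s - t) < d \<longrightarrow>
          norm (H s - H t - (s - t) *\<^sub>R K *\<^sub>R ?w) \<le> e * norm (s - t)"
        by blast
    qed
  qed simp
  moreover have "H 0 = 0"
    unfolding H_def by (intro set_integral_negligible negligible_triangle) (simp add: C_def cross2_def)
  ultimately show ?thesis
    by (simp add: H_def C_def K_def)
qed

subsection \<open>The boundary sum\<close>

text \<open>Expanding \<open>d\<close> in the orthogonal vectors \<open>c\<close> and
  \<open>rot c\<close> gives \<open>(c \<bullet> c) *\<^sub>R d = (c \<bullet> d) *\<^sub>R c +
  cross2 c d *\<^sub>R rot c\<close>. Applying \<open>rot\<close>, whose square is negation, yields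
  the identity.\<close>

lemma inner_mult_rot:
  "(c \<bullet> d) *\<^sub>R rot c = (c \<bullet> c) *\<^sub>R rot d + cross2 c d *\<^sub>R c"
  by (simp add: vec_eq_iff forall_2 inner_vec_def sum_2 cross2_def algebra_simps)

text \<open>With \<open>c t = A + t *\<^sub>R (B - A) - m\<close>, the integrand is the derivative
  of \<open>norm (c t) *\<^sub>R rot (c t)\<close> wherever \<open>c t\<close> is nonzero, so the
  integral is a difference of endpoint values.\<close>

lemma segment_integral_identity:
  fixes m A B :: "real^2"
  shows "((\<lambda>t. cross2 (A - m) (B - m) *\<^sub>R sgn (A + t *\<^sub>R (B - A) - m) +
        (2 * norm (A + t *\<^sub>R (B - A) - m)) *\<^sub>R rot (B - A)) has_integral
     norm (B - m) *\<^sub>R rot (B - m) - norm (A - m) *\<^sub>R rot (A - m)) {0..1}"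
proof (cases "A = B")
  case True
  then show ?thesis by (simp add: cross2_def)
next
  case False
  define d where "d = B - A"
  define c where "c = (\<lambda>t. A + t *\<^sub>R d - m)"
  have d: "d \<noteq> 0" using False by (simp add: d_def)
  interpret rot: bounded_linear rot
    using linear_rot by (simp add: linear_conv_bounded_linear)
  have cross: "cross2 (c t) d = cross2 (A - m) (B - m)" for t
    by (simp add: c_def d_def cross2_def algebra_simps)
  have c': "(c has_vector_derivative d) (at t)" for t
    unfolding c_def by (auto intro!: derivative_eq_intros)
  \<comment> \<open>The norm is not differentiable at the origin. The injective path
    \<open>c\<close> meets it at most once, and the fundamental theorem tolerates finitely many
    exceptions given continuity.\<close>
  have "finite {t. c t = 0}"
  proof -
    have "s = t" if "c s = 0" "c t = 0" for s t
    proof -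
      have "(s - t) *\<^sub>R d = c s - c t" by (simp add: c_def algebra_simps)
      with that d show ?thesis by simp
    qed
    then have "{s. c s = 0} \<subseteq> {t}" if "c t = 0" for t
      using that by blast
    then have "finite {s. c s = 0}" if "c t = 0" for t
      using that by (meson finite.emptyI finite.insertI finite_subset)
    then show ?thesis
      by (cases "\<exists>t. c t = 0") auto
  qed
  moreover have "((\<lambda>t. norm (c t) *\<^sub>R rot (c t)) has_vector_derivative
      cross2 (A - m) (B - m) *\<^sub>R sgn (c t) + (2 * norm (c t)) *\<^sub>R rot d) (at t)"
    if "c t \<noteq> 0" for t
  proof -
    have "((\<lambda>t. norm (c t)) has_vector_derivative (d \<bullet> sgn (c t))) (at t)"
      using has_derivative_compose [OF c' [unfolded has_vector_derivative_def] GDERIV_norm [OF that, unfolded gderiv_def]]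
      by (simp add: has_vector_derivative_def)
    then have deriv: "((\<lambda>t. norm (c t) *\<^sub>R rot (c t)) has_vector_derivative
        norm (c t) *\<^sub>R rot d + (d \<bullet> sgn (c t)) *\<^sub>R rot (c t)) (at t)"
      by (intro has_vector_derivative_scaleR rot.has_vector_derivative c')
        (simp add: has_real_derivative_iff_has_vector_derivative)
    \<comment> \<open>The second term of the product rule contains another copy of the first, whence
      the factor 2, and the constant cross product.\<close>
    have "(d \<bullet> sgn (c t)) *\<^sub>R rot (c t) = (1 / norm (c t)) *\<^sub>R (c t \<bullet> d) *\<^sub>R rot (c t)"
      by (simp add: sgn_div_norm inner_commute divide_inverse)
    also have "\<dots> = norm (c t) *\<^sub>R rot d + cross2 (A - m) (B - m) *\<^sub>R sgn (c t)"
      unfolding inner_mult_rot cross using that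
      by (simp add: sgn_div_norm scaleR_add_right dot_square_norm power2_eq_square field_simps)
    finally have "norm (c t) *\<^sub>R rot d + (d \<bullet> sgn (c t)) *\<^sub>R rot (c t) =
        cross2 (A - m) (B - m) *\<^sub>R sgn (c t) + (2 * norm (c t)) *\<^sub>R rot d"
      unfolding mult_2 scaleR_add_left by simp
    with deriv show ?thesis
      by (simp only:)
  qed
  moreover have "continuous_on {0..1} (\<lambda>t. norm (c t) *\<^sub>R rot (c t))"
    unfolding c_def by (intro continuous_intros rot.continuous_on)
  ultimately have "((\<lambda>t. cross2 (A - m) (B - m) *\<^sub>R sgn (c t) + (2 * norm (c t)) *\<^sub>R rot d) has_integral
      norm (c 1) *\<^sub>R rot (c 1) - norm (c 0) *\<^sub>R rot (c 0)) {0..1}"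
    by (intro fundamental_theorem_of_calculus_interior_strong [of "{t. c t = 0}"]) auto
  then show ?thesis
    by (simp add: c_def d_def)
qed

text \<open>Half of \<open>segment_integral_identity\<close>, with the orientation sign turning
  \<open>\<bar>D\<bar> / 2\<close> into \<open>D / 2\<close>. Each of the first two terms on the
  right involves a single vertex, so they telescope over the fan.\<close>

lemma triangle_integral_sgn:
  fixes m A B :: "real^2"
  shows "sgn (cross2 (A - m) (B - m)) *\<^sub>R (LINT z:convex hull {m, A, B}|lebesgue. sgn (z - m)) =
    (1/2) *\<^sub>R (norm (B - m) *\<^sub>R rot (B - m)) - (1/2) *\<^sub>R (norm (A - m) *\<^sub>R rot (A - m))
    - integral {0..1} (\<lambda>t. norm (A + t *\<^sub>R (B - A) - m)) *\<^sub>R rot (B - A)"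
    (is "?lhs = ?rhs")
proof -
  define D where "D = cross2 (A - m) (B - m)"
  let ?c = "\<lambda>t. A + t *\<^sub>R (B - A) - m"
  let ?W = "integral {0..1} (\<lambda>t. norm (?c t))"
  have "((\<lambda>t. norm (?c t)) has_integral ?W) {0..1}"
    by (intro integrable_integral integrable_continuous_interval continuous_intros)
  then have "((\<lambda>t. norm (?c t) *\<^sub>R rot (B - A)) has_integral ?W *\<^sub>R rot (B - A)) {0..1}"
    by (rule has_integral_scaleR_left)
  moreover note has_integral_cmul [OF segment_integral_identity [of A m B], of "1/2"]
  ultimately have "((\<lambda>t. (1/2) *\<^sub>R (D *\<^sub>R sgn (?c t) + (2 * norm (?c t)) *\<^sub>R rot (B - A)) -
      norm (?c t) *\<^sub>R rot (B - A)) has_integral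
      (1/2) *\<^sub>R (norm (B - m) *\<^sub>R rot (B - m) - norm (A - m) *\<^sub>R rot (A - m)) - ?W *\<^sub>R rot (B - A)) {0..1}"
    unfolding D_def by (intro has_integral_diff)
  then have *: "((\<lambda>t. (D / 2) *\<^sub>R sgn (?c t)) has_integral ?rhs) {0..1}"
    by (simp add: scaleR_add_right scaleR_diff_right)
  show ?thesis
  \<comment> \<open>In the degenerate case \<open>sgn 0 = 0\<close> kills the left side, and
    \<open>*\<close> integrates the zero function.\<close>
  proof (cases "D = 0")
    case True
    with * show ?thesis
      by (simp add: D_def has_integral_is_0 has_integral_unique)
  next
    case False
    have "((\<lambda>t. sgn D *\<^sub>R (\<bar>D\<bar> / 2) *\<^sub>R sgn (?c t)) has_integral ?lhs) {0..1}"
      using has_integral_cmul [OF triangle_integral_eq_segment_integral] False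
      unfolding D_def by blast
    moreover have "sgn D * (\<bar>D\<bar> / 2) = D / 2"
      by (simp add: sgn_mult_abs)
    ultimately have "((\<lambda>t. (D / 2) *\<^sub>R sgn (?c t)) has_integral ?lhs) {0..1}"
      by simp
    with * show ?thesis
      by (rule has_integral_unique [rotated])
  qed
qed

text \<open>\<open>linepath\<close> has constant speed \<open>norm (B - A)\<close>. Dividing by the
  length of a nondegenerate edge thus leaves the mean distance from \<open>m\<close> to the
  edge.\<close>

lemma segment_dist_sum_eq:
  "segment_dist_sum A B m = integral {0..1} (\<lambda>t. norm (A + t *\<^sub>R (B - A) - m)) * norm (B - A)"
proof -
  have "segment_dist_sum A B m = integral {0..1} (\<lambda>t. norm (A + t *\<^sub>R (B - A) - m) * norm (B - A))"
    unfolding segment_dist_sum_def arclength_integral_def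
  proof (rule integral_cong)
    fix t :: real assume "t \<in> {0..1}"
    then have "vector_derivative (linepath A B) (at t within {0..1}) = B - A"
      by (intro vector_derivative_linepath_within) auto
    moreover have "linepath A B t = A + t *\<^sub>R (B - A)"
      by (simp add: linepath_def algebra_simps)
    ultimately show "norm (linepath A B t - m) * norm (vector_derivative (linepath A B) (at t within {0..1}))
      = norm (A + t *\<^sub>R (B - A) - m) * norm (B - A)" by simp
  qed
  then show ?thesis by simp
qed

section \<open>Measurability of the region and integration over the fan\<close>

lemma lmeasurable_polygonal_region: "polygonal_region n P \<in> lmeasurable"
  and open_polygonal_region: "open (polygonal_region n P)"
  and bounded_polygonal_region: "bounded (polygonal_region n P)"
proof -
  have "compact (path_image (closed_polygon n P))"
    by (simp add: closed_polygon_def compact_path_image)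
  then show "open (polygonal_region n P)" "bounded (polygonal_region n P)"
    by (simp_all add: polygonal_region_def open_inside bounded_inside compact_imp_closed compact_imp_bounded)
  then show "polygonal_region n P \<in> lmeasurable"
    by (simp add: lmeasurable_open)
qed

lemma negligible_closed_segment:
  fixes a b :: "'a::euclidean_space"
  assumes "2 \<le> DIM('a)"
  shows "negligible (closed_segment a b)"
  using assms by (simp add: negligible_convex_interior interior_closed_segment_ge2)

text \<open>The indicator identity holds off finitely many segments, which are null sets in the
  plane; it is multiplied by \<open>sgn (z - m)\<close> and integrated.\<close>

lemma region_integral_sgn_fan:
  assumes simple: "simple_closed_polygon n P" and closed: "P (n + 1) = P 1"
  obtains \<epsilon> :: real where "\<bar>\<epsilon>\<bar> = 1"
    and "\<epsilon> *\<^sub>R (LINT z:polygonal_region n P|lebesgue. sgn (z - m)) =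
      (\<Sum>i = 1..n. sgn (cross2 (P i - m) (P (i + 1) - m)) *\<^sub>R
        (LINT z:convex hull {m, P i, P (i + 1)}|lebesgue. sgn (z - m)))"
proof -
  obtain \<epsilon> :: real where e: "\<bar>\<epsilon>\<bar> = 1"
    and fan: "\<And>z. \<lbrakk>\<And>i. i \<in> {1..n} \<Longrightarrow> z \<notin> closed_segment (P i) (P (i + 1)) \<and>
            z \<notin> closed_segment m (P i) \<and> z \<notin> closed_segment (P (i + 1)) m\<rbrakk> \<Longrightarrow>
      (\<Sum>i = 1..n. sgn (cross2 (P i - m) (P (i + 1) - m)) *
          indicator (convex hull {m, P i, P (i + 1)}) z) = \<epsilon> * indicator (polygonal_region n P) z"
    using polygon_fan_indicator [OF assms, of m] by blast
  let ?s = "\<lambda>i. sgn (cross2 (P i - m) (P (i + 1) - m))" and ?T = "\<lambda>i. convex hull {m, P i, P (i + 1)}"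
  let ?\<Omega> = "polygonal_region n P"
  define N where "N = (\<Union>i\<in>{1..n}. closed_segment (P i) (P (i + 1)) \<union>
      closed_segment m (P i) \<union> closed_segment (P (i + 1)) m)"
  have "negligible N"
    unfolding N_def by (intro negligible_Union) (auto intro!: negligible_Un negligible_closed_segment)
  then have "AE z in lebesgue. z \<notin> N"
    by (intro AE_not_in) (simp add: negligible_iff_null_sets)
  then have ae: "AE z in lebesgue. \<epsilon> *\<^sub>R (indicator ?\<Omega> z *\<^sub>R sgn (z - m)) =
      (\<Sum>i = 1..n. ?s i *\<^sub>R (indicator (?T i) z *\<^sub>R sgn (z - m)))"
  proof eventually_elim
    case (elim z)
    then have "(\<Sum>i = 1..n. ?s i * indicator (?T i) z) = \<epsilon> * indicator ?\<Omega> z"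
      by (intro fan) (auto simp: N_def)
    then show ?case
      by (simp add: scaleR_sum_left [symmetric] del: sum_mult_indicator)
  qed
  have int\<Omega>: "integrable lebesgue (\<lambda>z. indicator ?\<Omega> z *\<^sub>R sgn (z - m))"
    using set_integrable_sgn [OF lmeasurable_polygonal_region] by (simp add: set_integrable_def)
  have intT: "integrable lebesgue (\<lambda>z. indicator (?T i) z *\<^sub>R sgn (z - m))" for i
    using set_integrable_sgn [OF lmeasurable_triangle] by (simp add: set_integrable_def)
  have "(LINT z|lebesgue. \<epsilon> *\<^sub>R (indicator ?\<Omega> z *\<^sub>R sgn (z - m))) =
      (LINT z|lebesgue. (\<Sum>i = 1..n. ?s i *\<^sub>R (indicator (?T i) z *\<^sub>R sgn (z - m))))"
    using int\<Omega> intT ae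
    by (intro integral_cong_AE borel_measurable_integrable Bochner_Integration.integrable_sum
        integrable_scaleR_right) auto
  also have "\<dots> = (\<Sum>i = 1..n. ?s i *\<^sub>R (LINT z|lebesgue. indicator (?T i) z *\<^sub>R sgn (z - m)))"
    using intT by (subst Bochner_Integration.integral_sum)
      (auto simp del: scaleR_scaleR intro!: integrable_scaleR_right)
  finally show ?thesis
    using that [OF e] by (simp add: set_lebesgue_integral_def del: scaleR_scaleR)
qed

lemma region_integral_sgn_eq_0_iff:
  assumes "simple_closed_polygon n P" "P (n + 1) = P 1"
  shows "(LINT z:polygonal_region n P|lebesgue. sgn (z - m)) = 0 \<longleftrightarrow>
    (\<Sum>i = 1..n. (segment_dist_sum (P i) (P (i + 1)) m / norm (P (i + 1) - P i))
                 *\<^sub>R (P (i + 1) - P i)) = 0"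
proof -
  interpret rot: linear rot
    by (rule linear_rot)
  have n: "n \<ge> 3" using assms(1) by (simp add: simple_closed_polygon_def)
  let ?W = "\<lambda>i. integral {0..1} (\<lambda>t. norm (P i + t *\<^sub>R (P (i + 1) - P i) - m))"
  let ?K = "\<lambda>i. (1/2) *\<^sub>R (norm (P i - m) *\<^sub>R rot (P i - m))"
  let ?S = "\<Sum>i = 1..n. (segment_dist_sum (P i) (P (i + 1)) m / norm (P (i + 1) - P i))
                 *\<^sub>R (P (i + 1) - P i)"
  obtain \<epsilon> :: real where e: "\<bar>\<epsilon>\<bar> = 1"
    and "\<epsilon> *\<^sub>R (LINT z:polygonal_region n P|lebesgue. sgn (z - m)) =
      (\<Sum>i = 1..n. sgn (cross2 (P i - m) (P (i + 1) - m)) *\<^sub>R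
        (LINT z:convex hull {m, P i, P (i + 1)}|lebesgue. sgn (z - m)))"
    using region_integral_sgn_fan [OF assms] by blast
  note this(2)
  also have "(\<Sum>i = 1..n. sgn (cross2 (P i - m) (P (i + 1) - m)) *\<^sub>R
        (LINT z:convex hull {m, P i, P (i + 1)}|lebesgue. sgn (z - m))) =
      (\<Sum>i = 1..n. ?K (Suc i) - ?K i) - (\<Sum>i = 1..n. ?W i *\<^sub>R rot (P (i + 1) - P i))"
    unfolding triangle_integral_sgn by (simp add: sum_subtractf)
  \<comment> \<open>The vertex terms cancel because the polygon closes up; only rotated edges
    remain.\<close>
  also have "(\<Sum>i = 1..n. ?K (Suc i) - ?K i) = 0"
    using n assms(2) sum_Suc_diff [of 1 n ?K] by simp
  also have "(\<Sum>i = 1..n. ?W i *\<^sub>R rot (P (i + 1) - P i)) = rot (\<Sum>i = 1..n. ?W i *\<^sub>R (P (i + 1) - P i))"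
    by (simp only: rot.sum rot.scaleR)
  also have "(\<Sum>i = 1..n. ?W i *\<^sub>R (P (i + 1) - P i)) = ?S"
  proof (rule sum.cong [OF refl])
    fix i
    show "?W i *\<^sub>R (P (i + 1) - P i) = (segment_dist_sum (P i) (P (i + 1)) m / norm (P (i + 1) - P i))
                 *\<^sub>R (P (i + 1) - P i)"
      \<comment> \<open>For an edge of length 0 the division yields the default 0, and both sides
        vanish with the edge vector.\<close>
      by (cases "P (i + 1) = P i") (simp_all add: segment_dist_sum_eq)
  qed
  finally have eq: "\<epsilon> *\<^sub>R (LINT z:polygonal_region n P|lebesgue. sgn (z - m)) = - rot ?S"
    by (simp only: diff_0)
  have "\<epsilon> \<noteq> 0" using e by auto
  then have "(LINT z:polygonal_region n P|lebesgue. sgn (z - m)) = 0 \<longleftrightarrow>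
      \<epsilon> *\<^sub>R (LINT z:polygonal_region n P|lebesgue. sgn (z - m)) = 0"
    by (simp only: scaleR_eq_0_iff) simp
  then show ?thesis
    by (simp only: eq neg_equal_0_iff_equal rot_eq_0_iff)
qed

subsection \<open>Minimising the distance sum\<close>

text \<open>Minus the integral of \<open>sgn (z - Y)\<close> is a subgradient at \<open>Y\<close>.
  The pointwise gap \<open>r\<close> is nonnegative by Cauchy-Schwarz, and it vanishes only on the
  line through \<open>X\<close> and \<open>Y\<close>, hence strictness on a set of positive
  measure.\<close>

lemma region_dist_sum_subgradient:
  assumes bdd: "bounded \<Omega>" and meas: "\<Omega> \<in> lmeasurable"
  shows "region_dist_sum \<Omega> X \<ge> region_dist_sum \<Omega> Y + (LINT z:\<Omega>|lebesgue. sgn (z - Y)) \<bullet> (Y - X)"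
    and "\<lbrakk>X \<noteq> Y; \<not> negligible \<Omega>\<rbrakk> \<Longrightarrow>
      region_dist_sum \<Omega> X > region_dist_sum \<Omega> Y + (LINT z:\<Omega>|lebesgue. sgn (z - Y)) \<bullet> (Y - X)"
proof -
  obtain b where b: "\<And>z. z \<in> \<Omega> \<Longrightarrow> norm z \<le> b"
    using bdd by (auto simp: bounded_iff)
  have int_norm: "set_integrable lebesgue \<Omega> (\<lambda>z. norm (z - x))" for x
  proof (rule set_integrable_bounded [where c = "b + norm x"])
    show "norm (norm (z - x)) \<le> b + norm x" if "z \<in> \<Omega>" for z
      using b [OF that] norm_triangle_ineq4 [of z x] by simp
  qed (use meas in auto)
  have int_sgn: "set_integrable lebesgue \<Omega> (\<lambda>z. sgn (z - Y))"
    using meas by simp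
  have inner: "integrable lebesgue (\<lambda>z. (indicator \<Omega> z *\<^sub>R sgn (z - Y)) \<bullet> (Y - X))"
    using int_sgn unfolding set_integrable_def by (intro integrable_inner_left)
  define r where "r = (\<lambda>z. norm (z - X) - norm (z - Y) - sgn (z - Y) \<bullet> (Y - X))"
  have r_eq: "r z = norm (z - X) - sgn (z - Y) \<bullet> (z - X)" for z
  proof -
    have "norm (z - Y) = sgn (z - Y) \<bullet> (z - Y)"
      by (cases "z = Y") (simp_all add: sgn_div_norm dot_square_norm power2_eq_square)
    then show ?thesis
      by (simp add: r_def algebra_simps)
  qed
  have r_nonneg: "r z \<ge> 0" for z
    using norm_cauchy_schwarz [of "sgn (z - Y)" "z - X"] by (simp add: r_eq norm_sgn split: if_splits)
  have ind: "indicator \<Omega> z *\<^sub>R r z = indicator \<Omega> z *\<^sub>R norm (z - X) - indicator \<Omega> z *\<^sub>R norm (z - Y)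
      - (indicator \<Omega> z *\<^sub>R sgn (z - Y)) \<bullet> (Y - X)" for z
    by (simp add: r_def algebra_simps)
  have r_int: "integrable lebesgue (\<lambda>z. indicator \<Omega> z *\<^sub>R r z)"
    unfolding ind using int_norm inner by (intro Bochner_Integration.integrable_diff) (auto simp: set_integrable_def)
  have r_LINT: "(LINT z|lebesgue. indicator \<Omega> z *\<^sub>R r z) =
      region_dist_sum \<Omega> X - region_dist_sum \<Omega> Y - (LINT z:\<Omega>|lebesgue. sgn (z - Y)) \<bullet> (Y - X)"
  proof -
    have "(LINT z|lebesgue. (indicator \<Omega> z *\<^sub>R sgn (z - Y)) \<bullet> (Y - X)) =
        (LINT z:\<Omega>|lebesgue. sgn (z - Y)) \<bullet> (Y - X)"
      using int_sgn unfolding set_lebesgue_integral_def set_integrable_def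
      by (intro integral_inner_left)
    then show ?thesis
      unfolding ind region_dist_sum_def set_lebesgue_integral_def
      using int_norm inner by (simp add: set_integrable_def)
  qed
  have nonneg: "(LINT z|lebesgue. indicator \<Omega> z *\<^sub>R r z) \<ge> 0"
    using r_nonneg by (intro Bochner_Integration.integral_nonneg) auto
  then show "region_dist_sum \<Omega> X \<ge> region_dist_sum \<Omega> Y + (LINT z:\<Omega>|lebesgue. sgn (z - Y)) \<bullet> (Y - X)"
    using r_LINT by simp
  show "region_dist_sum \<Omega> X > region_dist_sum \<Omega> Y + (LINT z:\<Omega>|lebesgue. sgn (z - Y)) \<bullet> (Y - X)"
    if "X \<noteq> Y" "\<not> negligible \<Omega>"
  proof (rule ccontr)
    assume "\<not> ?thesis"
    then have "(LINT z|lebesgue. indicator \<Omega> z *\<^sub>R r z) = 0"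
      using nonneg r_LINT by simp
    then have ae: "AE z in lebesgue. indicator \<Omega> z *\<^sub>R r z = 0"
      using integral_nonneg_eq_0_iff_AE [OF r_int] r_nonneg by simp
    let ?line = "{z. rot (X - Y) \<bullet> z = rot (X - Y) \<bullet> Y}"
    \<comment> \<open>Equality in Cauchy-Schwarz makes \<open>z - X\<close> a multiple of
      \<open>z - Y\<close>, so \<open>z\<close> is collinear with \<open>X\<close> and
      \<open>Y\<close>.\<close>
    have line: "z \<in> ?line" if "r z = 0" for z
    proof (cases "z = Y")
      case False
      then have "sgn (z - Y) \<bullet> (z - X) = norm (sgn (z - Y)) * norm (z - X)"
        using that by (simp add: r_eq norm_sgn)
      then have "z - X = norm (z - X) *\<^sub>R sgn (z - Y)"
        using False by (simp only: norm_cauchy_schwarz_eq) (simp add: norm_sgn)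
      then have "rot (z - Y) \<bullet> (z - X) = rot (z - Y) \<bullet> (norm (z - X) *\<^sub>R sgn (z - Y))"
        by (rule arg_cong)
      also have "\<dots> = 0"
        by (simp add: sgn_div_norm flip: cross2_eq_inner_rot) (simp add: cross2_def)
      finally show ?thesis
        by (simp add: inner_vec_def sum_2 algebra_simps)
    qed simp
    have "negligible ?line"
      using \<open>X \<noteq> Y\<close> by (intro negligible_hyperplane) simp
    then have "AE z in lebesgue. z \<notin> ?line"
      by (intro AE_not_in) (simp add: negligible_iff_null_sets)
    with ae have "AE z in lebesgue. z \<notin> \<Omega>"
      by eventually_elim (use line in \<open>auto simp: indicator_def split: if_splits\<close>)
    then have "\<Omega> \<in> null_sets lebesgue"
      using meas by (simp add: AE_iff_null_sets fmeasurableD)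
    with \<open>\<not> negligible \<Omega>\<close> show False
      by (simp add: negligible_iff_null_sets)
  qed
qed

text \<open>Dominated convergence: the integrands are bounded by the indicator of
  \<open>\<Omega>\<close> and converge except at \<open>z = m\<close>, where \<open>sgn\<close>
  jumps. This continuity replaces differentiation under the integral sign.\<close>

lemma region_integral_sgn_tendsto:
  fixes m :: "'a::euclidean_space"
  assumes "\<Omega> \<in> lmeasurable" and X: "X \<longlonglongrightarrow> m"
  shows "(\<lambda>k. LINT z:\<Omega>|lebesgue. sgn (z - X k)) \<longlonglongrightarrow> (LINT z:\<Omega>|lebesgue. sgn (z - m))"
  unfolding set_lebesgue_integral_def
proof (rule integral_dominated_convergence [where w = "indicator \<Omega>"])
  have int: "integrable lebesgue (\<lambda>z. indicator \<Omega> z *\<^sub>R sgn (z - x))" for x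
    using set_integrable_sgn [OF assms(1)] by (simp add: set_integrable_def)
  show "(\<lambda>z. indicator \<Omega> z *\<^sub>R sgn (z - m)) \<in> borel_measurable lebesgue"
    "(\<lambda>z. indicator \<Omega> z *\<^sub>R sgn (z - X k)) \<in> borel_measurable lebesgue" for k
    using int by (auto intro: borel_measurable_integrable)
  show "integrable lebesgue (indicator \<Omega> :: 'a \<Rightarrow> real)"
    using assms(1) by (simp add: lmeasurable_iff_integrable)
  have "AE z in lebesgue. z \<notin> {m}"
    by (rule AE_not_in) (simp flip: negligible_iff_null_sets)
  then show "AE z in lebesgue. (\<lambda>k. indicator \<Omega> z *\<^sub>R sgn (z - X k)) \<longlonglongrightarrow> indicator \<Omega> z *\<^sub>R sgn (z - m)"
    by eventually_elim (auto intro!: tendsto_intros X)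
  show "AE z in lebesgue. norm (indicator \<Omega> z *\<^sub>R sgn (z - X k)) \<le> indicator \<Omega> z" for k
    by (auto simp: norm_sgn indicator_def)
qed

text \<open>If the integral vanishes, the strict subgradient inequality makes \<open>m\<close> the
  unique minimiser. Conversely, a nonzero integral would be a direction of descent at
  \<open>m\<close>.\<close>

lemma is_geometric_median_iff:
  assumes bdd: "bounded \<Omega>" and meas: "\<Omega> \<in> lmeasurable" and nonnull: "\<not> negligible \<Omega>"
  shows "is_geometric_median \<Omega> m \<longleftrightarrow> (LINT z:\<Omega>|lebesgue. sgn (z - m)) = 0"
proof
  let ?G = "\<lambda>x. LINT z:\<Omega>|lebesgue. sgn (z - x)"
  assume "is_geometric_median \<Omega> m"
  then have min: "region_dist_sum \<Omega> m \<le> region_dist_sum \<Omega> Y" for Y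
    by (auto simp: is_geometric_median_def is_arg_min_def not_less set_eq_iff)
  \<comment> \<open>Points approaching \<open>m\<close> along \<open>?G m\<close>. The subgradient
    inequality at \<open>X k\<close>, compared with the minimal value at \<open>m\<close>, gives
    \<open>?G (X k) \<bullet> ?G m \<le> 0\<close>, and in the limit the squared norm of
    \<open>?G m\<close> is at most 0.\<close>
  define X where "X = (\<lambda>k. m + inverse (real (Suc k)) *\<^sub>R ?G m)"
  have "(\<lambda>k. m + inverse (real (Suc k)) *\<^sub>R ?G m) \<longlonglongrightarrow> m + 0 *\<^sub>R ?G m"
    by (intro tendsto_intros LIMSEQ_inverse_real_of_nat)
  then have "X \<longlonglongrightarrow> m"
    by (simp add: X_def)
  then have "(\<lambda>k. ?G (X k) \<bullet> ?G m) \<longlonglongrightarrow> ?G m \<bullet> ?G m"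
    by (intro tendsto_inner region_integral_sgn_tendsto meas tendsto_const)
  moreover have "?G (X k) \<bullet> ?G m \<le> 0" for k
  proof -
    have "?G (X k) \<bullet> (X k - m) \<le> 0"
      using region_dist_sum_subgradient(1) [OF bdd meas, of "X k" m] min [of "X k"] by linarith
    then show ?thesis
      by (simp add: X_def mult_le_0_iff)
  qed
  ultimately have "?G m \<bullet> ?G m \<le> 0"
    by (intro LIMSEQ_le_const2) auto
  then have "?G m \<bullet> ?G m = 0"
    using inner_ge_zero [of "?G m"] by (rule antisym)
  then show "?G m = 0"
    by (simp only: inner_eq_zero_iff)
next
  assume 0: "(LINT z:\<Omega>|lebesgue. sgn (z - m)) = 0"
  have "region_dist_sum \<Omega> m < region_dist_sum \<Omega> X" if "X \<noteq> m" for X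
    using region_dist_sum_subgradient(2) [OF bdd meas that nonnull] 0 by simp
  then show "is_geometric_median \<Omega> m"
    unfolding is_geometric_median_def is_arg_min_def by (auto simp: set_eq_iff) (metis less_asym')+
qed

text \<open>The Jordan curve theorem, transported from the complex plane.\<close>

lemma polygonal_region_nonempty:
  assumes "simple_closed_polygon n P"
  shows "polygonal_region n P \<noteq> {}"
proof -
  have n: "n \<ge> 3" and sp: "simple_path (closed_polygon n P)"
    using assms by (auto simp: simple_closed_polygon_def)
  let ?g = "to_complex \<circ> closed_polygon n P"
  have "simple_path ?g"
    using sp simple_path_linear_image_eq [OF linear_to_complex inj_to_complex] by simp
  moreover have "pathfinish ?g = pathstart ?g"
    using n by (simp add: closed_polygon_def pathfinish_compose pathstart_compose upt_conv_Cons)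
  ultimately have "inside (path_image ?g) \<noteq> {}"
    using Jordan_inside_outside by blast
  then show ?thesis
    using inside_linear_image [OF linear_to_complex inj_to_complex surj_to_complex]
    by (simp add: polygonal_region_def path_image_compose)
qed

theorem mainTheorem3:
  fixes n :: nat and P :: "nat \<Rightarrow> real^2" and m :: "real^2"
  assumes "simple_closed_polygon n P"
    and "P (n + 1) = P 1"
  shows "is_geometric_median (polygonal_region n P) m \<longleftrightarrow>
    (\<Sum>i = 1..n. (segment_dist_sum (P i) (P (i + 1)) m / norm (P (i + 1) - P i))
                 *\<^sub>R (P (i + 1) - P i)) = 0"
proof -
  \<comment> \<open>A nonempty open set has positive measure, which the uniqueness of the minimiser
    rests on.\<close>
  have "\<not> negligible (polygonal_region n P)"
    using open_not_negligible [OF open_polygonal_region polygonal_region_nonempty] assms by blast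
  then show ?thesis
    using is_geometric_median_iff [OF bounded_polygonal_region lmeasurable_polygonal_region]
      region_integral_sgn_eq_0_iff [OF assms] by blast
qed

end
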